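(* Let $m\ge 2$, $n=2m$, let $k$ be an integer with $1\le k\le m$, and let $t$ be an odd integer with $1\le t\le 2^m+1$. Set $s_1=2^{k-1}t-\frac{t-1}{2}$, $s_2=2^{k-1}t+\frac{t+1}{2}$, $d_1=s_1(2^m-1)+1$ and $d_2=s_2(2^m-1)+1$. Assume that $(2^k-1)t \not\equiv 0 \pmod{2^m+1}$ and $(2^k+1)t\not\equiv 0 \pmod{2^m+1}$, and let $l=\gcd(t,2^m+1)$. Suppose that at least one of the following conditions holds: (i) $m\equiv -1 \pmod k$; (ii) $\gcd(k,2m)=1$. For $a,b\in\mathbb{F}_{2^n}$ put $$T_1(a,b)=\sum_{x\in\mathbb{F}_{2^n}}(-1)^{\mathrm{Tr}_n(ax^{d_1}+bx^{d_2})}.$$ Then, as $(a,b)$ ranges over $\mathbb{F}_{2^n}\times\mathbb{F}_{2^n}$, the value distribution of $T_1(a,b)$ is as follows: \begin{itemize} \item the value $2^{2m}$ occurs $1$ time; \item the value $(3l-1)2^{m}$ occurs $\frac{(2^{2m}-1)(2^m+1-2l)(2^m+1-l)}{6l^3}$ times; \item the value $(2l-1)2^{m}$ occurs $\frac{(2^{2m}-1)((2^m+3)l-2^m-1)(2^m+1-l)}{2l^3}$ times; \item the value $(l-1)2^{m}$ occurs $\frac{(2^{2m}-1)\left((2^{2m+1}+2^{m+2}+6)l^2-(2^{2m+1}+7\cdot2^m+5)l+(2^m+1)^2\right)}{2l^3}$ times; \item the value $-2^{m}$ occurs $\frac{(2^{2m}-1)\left(6(2^{2m}+1)l^3-(6\cdot2^{2m}+9\cdot2^m+11)l^2+(3\cdot2^{2m}+9\cdot2^m+6)l-(2^m+1)^2\right)}{6l^3}$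 times. \end{itemize}
   Context: $\mathrm{Tr}_n$ denotes the absolute trace map from $\mathbb{F}_{2^n}$ to $\mathbb{F}_2$. The value distribution of $T_1(a,b)$ is the list of values taken together with the number of pairs $(a,b)\in\mathbb{F}_{2^n}\times\mathbb{F}_{2^n}$ at which each is taken. *)

theory Defs
  imports "HOL-Number_Theory.Number_Theory" "HOL-Library.Cardinality"
begin

text \<open>The trace from \<open>GF(2^n)\<close> to its prime field, kept as an element of the large field.
  It takes only the values 0 and 1; see \<open>abs_trace_in_F2\<close> below.\<close>

definition abs_trace :: "nat \<Rightarrow> 'a::finite_field \<Rightarrow> 'a" where
  "abs_trace n x = (\<Sum>i<n. x ^ (2 ^ i))"

text \<open>\<open>(-1)^u\<close> for \<open>u\<close> in the prime field \<open>{0, 1}\<close>; only meaningful for such arguments.\<close>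

definition sign_F2 :: "'a::finite_field \<Rightarrow> int" where
  "sign_F2 u = (if u = 0 then 1 else - 1)"

definition T1 :: "nat \<Rightarrow> nat \<Rightarrow> nat \<Rightarrow> 'a::finite_field \<Rightarrow> 'a \<Rightarrow> int" where
  "T1 n d1 d2 a b = (\<Sum>x\<in>UNIV. sign_F2 (abs_trace n (a * x ^ d1 + b * x ^ d2)))"

lemma CHAR_eq_2:
  assumes "CARD('a::finite_field) = 2 ^ n"
  shows "CHAR('a) = 2"
proof -
  have "CHAR('a) dvd 2 ^ n"
    using CHAR_dvd_CARD[where ?'a = 'a] assms by simp
  then have "CHAR('a) dvd 2"
    using prime_dvd_power CHAR_prime by blast
  then show ?thesis
    using CHAR_prime[where ?'a = 'a] by (simp add: primes_dvd_imp_eq)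
qed

lemma abs_trace_in_F2:
  fixes x :: "'a::finite_field"
  assumes card: "CARD('a) = 2 ^ n"
  shows "abs_trace n x \<in> {0, 1}"
proof -
  have "of_nat CHAR('a) = (0 :: 'a)" by (rule of_nat_CHAR)
  then have two: "(2 :: 'a) = 0" by (simp add: CHAR_eq_2[OF card])
  have sq: "(\<Sum>i<k. f i)\<^sup>2 = (\<Sum>i<k. (f i)\<^sup>2)" for f :: "nat \<Rightarrow> 'a" and k
    by (induction k) (simp_all add: power2_sum two)
  have "(abs_trace n x)\<^sup>2 = (\<Sum>i<n. x ^ (2 ^ Suc i))"
    unfolding abs_trace_def sq by (simp add: power_mult[symmetric] mult.commute)
  also have "\<dots> = (\<Sum>i<Suc n. x ^ (2 ^ i)) - x"
    by (subst sum.lessThan_Suc_shift) simp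
  also have "\<dots> = abs_trace n x"
    using finite_field_power_card_eq_same[of x] card by (simp add: abs_trace_def)
  finally have "abs_trace n x * (abs_trace n x - 1) = 0"
    by (simp add: power2_eq_square algebra_simps)
  then show ?thesis by auto
qed

end

theory Submission
  imports Defs "HOL-Library.Product_Plus" "HOL-Computational_Algebra.Polynomial"
begin

text \<open>
  Write \<open>q = 2 ^ m\<close>, \<open>U = {z. z ^ (q + 1) = 1}\<close>, \<open>K = GF(q)\<close>. The polar decomposition \<open>x = y * z\<close> with
  \<open>y \<in> K - {0}\<close>, \<open>z \<in> U\<close> gives \<open>T1 = (N - 1) * q\<close>, where \<open>N\<close> counts the \<open>z \<in> U\<close> at which a \<open>K\<close>-valued
  form in \<open>w = z ^ t\<close>, additive in \<open>(a, b)\<close>, vanishes.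
  As \<open>z \<mapsto> z ^ t\<close> is \<open>l\<close>-to-one on \<open>U\<close>, \<open>N = l * M\<close> with \<open>M\<close> the number
  of zeros in a subgroup of order \<open>h = (q + 1) / l\<close>. Both alternatives (i) and (ii) give \<open>coprime k m\<close>,
  and then a cross ratio argument shows \<open>M \<le> 3\<close> unless \<open>a = b = 0\<close>. Consequently vanishing at \<open>j \<le> 4\<close> given
  points leaves exactly \<open>q ^ (4 - j)\<close> pairs \<open>(a, b)\<close>, which yields the binomial moments of \<open>M\<close> of orders 0
  to 3, and these determine the distribution. The two non-congruences ensure \<open>h > 3\<close>, so that the zero
  pair is told apart from the others.
\<close>

section \<open>Counting tools: fibres, double counting, roots of unity\<close>

lemma card_eq_sum_fibres:
  assumes "finite A"
  shows "card A = (\<Sum>c\<in>f ` A. card {x \<in> A. f x = c})"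
  using sum.image_gen[OF assms, of "\<lambda>_. 1::nat" f] by simp

text \<open>A nonempty fibre of an additive map is translated into the kernel by subtracting one of
  its points, and there are at most \<open>card B\<close> such fibres.\<close>

lemma additive_card_le:
  fixes f :: "'b::ab_group_add \<Rightarrow> 'c::ab_group_add"
  assumes G: "finite G" "\<And>x y. x \<in> G \<Longrightarrow> y \<in> G \<Longrightarrow> x - y \<in> G"
    and f: "\<And>x y. f (x - y) = f x - f y"
    and B: "finite B" "f ` G \<subseteq> B"
  shows "card G \<le> card B * card {x \<in> G. f x = 0}"
proof -
  have "card {x \<in> G. f x = c} \<le> card {x \<in> G. f x = 0}" if c: "c \<in> f ` G" for c
  proof -
    obtain x0 where x0: "x0 \<in> G" "f x0 = c" using c by blast
    show ?thesis
      by (rule card_inj_on_le[where f = "\<lambda>x. x - x0"]) (use x0 G f in \<open>auto simp: inj_on_def\<close>)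
  qed
  then have "card G \<le> (\<Sum>c\<in>f ` G. card {x \<in> G. f x = 0})"
    unfolding card_eq_sum_fibres[OF G(1), of f] by (rule sum_mono)
  also have "\<dots> \<le> card B * card {x \<in> G. f x = 0}"
    using card_mono[OF B] by simp
  finally show ?thesis .
qed

text \<open>Double counting of the pairs \<open>(x, S)\<close> with \<open>S\<close> a
  \<open>j\<close>-subset of \<open>H\<close> all of whose points are related to \<open>x\<close>.
  This is the source of the binomial moments.\<close>

lemma sum_card_choose:
  assumes X: "finite X" and H: "finite H"
    and c: "\<And>S. S \<subseteq> H \<Longrightarrow> card S = j \<Longrightarrow> card {x \<in> X. \<forall>w\<in>S. R x w} = c"
  shows "(\<Sum>x\<in>X. card {w \<in> H. R x w} choose j) = (card H choose j) * c"
proof -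
  let ?P = "{S. S \<subseteq> H \<and> card S = j}"
  have finP: "finite ?P" using H by auto
  have "(card {w \<in> H. R x w} choose j) = (\<Sum>S\<in>?P. if \<forall>w\<in>S. R x w then 1 else 0)" for x
  proof -
    have "(card {w \<in> H. R x w} choose j) = card {S. S \<subseteq> {w \<in> H. R x w} \<and> card S = j}" (is "_ = card ?L")
      using n_subsets[of "{w \<in> H. R x w}" j] H by simp
    also have "?L = {S \<in> ?P. \<forall>w\<in>S. R x w}"
      by auto
    finally show ?thesis using finP by (simp add: sum.If_cases Int_def)
  qed
  then have "(\<Sum>x\<in>X. card {w \<in> H. R x w} choose j) = (\<Sum>x\<in>X. \<Sum>S\<in>?P. if \<forall>w\<in>S. R x w then 1 else 0)"
    by simp
  also have "\<dots> = (\<Sum>S\<in>?P. \<Sum>x\<in>X. if \<forall>w\<in>S. R x w then 1 else 0)"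
    by (rule sum.swap)
  also have "\<dots> = (\<Sum>S\<in>?P. c)"
    using X c by (intro sum.cong) (simp_all add: sum.If_cases Int_def)
  finally show ?thesis using n_subsets[OF H, of j] by simp
qed

lemma card_power_eq_le:
  fixes c :: "'a::idom"
  assumes "d > 0"
  shows "card {x. x ^ d = c} \<le> d"
proof -
  let ?p = "monom 1 d - [:c:]"
  have "coeff ?p d = 1" using assms by (cases d) auto
  then have "?p \<noteq> 0" by (metis coeff_0 zero_neq_one)
  moreover have "degree ?p \<le> d" by (intro degree_diff_le) (auto simp: degree_monom_le)
  ultimately have "card {x. poly ?p x = 0} \<le> d"
    using card_poly_roots_bound[of ?p] by linarith
  then show ?thesis by (simp add: poly_monom)
qed

text \<open>The \<open>e\<close>-th power map sends the \<open>d * e\<close> nonzero elements into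
  the \<open>d\<close>-th roots of unity with fibres of size at most \<open>e\<close>, so there are
  at least \<open>d\<close> such roots; the degree bound gives at most \<open>d\<close>.\<close>

lemma card_roots_of_unity:
  assumes "d * e = CARD('a::finite_field) - 1"
  shows "card {x::'a. x ^ d = 1} = d"
proof -
  have "CARD('a) > 1"
    using card_mono[of UNIV "{0::'a, 1}"] by simp
  then have pos: "d > 0" "e > 0" using assms by (auto intro!: Nat.gr0I)
  let ?A = "- {0::'a}" and ?R = "{x::'a. x ^ d = 1}"
  have img: "(\<lambda>x. x ^ e) ` ?A \<subseteq> ?R"
  proof clarify
    fix x :: 'a assume "x \<noteq> 0"
    then have "x * x ^ (CARD('a) - 1) = x * 1"
      using finite_field_power_card_eq_same[of x] \<open>CARD('a) > 1\<close>
      by (metis One_nat_def Suc_pred' mult.right_neutral order.strict_trans power_Suc zero_less_one)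
    then show "(x ^ e) ^ d = 1"
      using \<open>x \<noteq> 0\<close> assms by (simp add: mult.commute flip: power_mult)
  qed
  have "d * e = card ?A" using assms by (simp add: Compl_eq_Diff_UNIV card_Diff_subset)
  also have "\<dots> = (\<Sum>c\<in>(\<lambda>x. x ^ e) ` ?A. card {x \<in> ?A. x ^ e = c})"
    by (rule card_eq_sum_fibres) simp
  also have "\<dots> \<le> (\<Sum>c\<in>(\<lambda>x. x ^ e) ` ?A. e)"
  proof (rule sum_mono)
    fix c :: 'a
    have "card {x \<in> ?A. x ^ e = c} \<le> card {x. x ^ e = c}" by (rule card_mono) auto
    also have "\<dots> \<le> e" using card_power_eq_le pos by blast
    finally show "card {x \<in> ?A. x ^ e = c} \<le> e" .
  qed
  also have "\<dots> \<le> card ?R * e" using card_mono[OF _ img] by simp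
  finally have "d \<le> card ?R" using pos by simp
  moreover have "card ?R \<le> d" using card_power_eq_le pos by blast
  ultimately show ?thesis by simp
qed

section \<open>Solving the moment equations\<close>

text \<open>The system is triangular, solved from \<open>N3\<close> down to \<open>N0\<close>.
  Multiplying by \<open>6 * l ^ 3\<close> clears all denominators and lets \<open>h\<close> enter
  only through \<open>h * l = q + 1\<close>.\<close>

lemma solve_moments:
  fixes q h l N0 N1 N2 N3 :: real
  assumes l: "l > 0" and hl: "q + 1 = h * l"
    and s0: "N0 + N1 + N2 + N3 = q ^ 4 - 1"
    and s1: "N1 + 2 * N2 + 3 * N3 = h * (q ^ 3 - 1)"
    and s2: "N2 + 3 * N3 = h * (h - 1) / 2 * (q ^ 2 - 1)"
    and s3: "N3 = h * (h - 1) * (h - 2) / 6 * (q - 1)"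
  shows "N3 = (q ^ 2 - 1) * (q + 1 - 2 * l) * (q + 1 - l) / (6 * l ^ 3)"
    and "N2 = (q ^ 2 - 1) * ((q + 3) * l - q - 1) * (q + 1 - l) / (2 * l ^ 3)"
    and "N1 = (q ^ 2 - 1) * ((2 * q ^ 2 + 4 * q + 6) * l ^ 2 - (2 * q ^ 2 + 7 * q + 5) * l + (q + 1) ^ 2)
          / (2 * l ^ 3)"
    and "N0 = (q ^ 2 - 1) * (6 * (q ^ 2 + 1) * l ^ 3 - (6 * q ^ 2 + 9 * q + 11) * l ^ 2
          + (3 * q ^ 2 + 9 * q + 6) * l - (q + 1) ^ 2) / (6 * l ^ 3)"
proof -
  have "6 * l ^ 3 * N3 = l ^ 3 * (h * (h - 1) * (h - 2) * (q - 1))"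
    using s3 by simp
  also have "\<dots> = (h * l) * (h * l - l) * (h * l - 2 * l) * (q - 1)"
    by (simp add: algebra_simps power3_eq_cube)
  finally have N3: "6 * l ^ 3 * N3 = (q + 1) * (q + 1 - l) * (q + 1 - 2 * l) * (q - 1)"
    by (simp only: hl)
  have "6 * l ^ 3 * (N2 + 3 * N3) = 3 * l ^ 3 * (h * (h - 1) * (q ^ 2 - 1))"
    unfolding s2 by simp
  also have "\<dots> = 3 * l * ((h * l) * (h * l - l) * (q ^ 2 - 1))"
    by (simp add: algebra_simps power2_eq_square power3_eq_cube)
  finally have N2: "6 * l ^ 3 * N2 = 3 * l * ((q + 1) * (q + 1 - l) * (q ^ 2 - 1)) - 3 * (6 * l ^ 3 * N3)"
    unfolding hl[symmetric] by (simp add: algebra_simps)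
  have "6 * l ^ 3 * (N1 + 2 * N2 + 3 * N3) = 6 * l ^ 2 * ((h * l) * (q ^ 3 - 1))"
    unfolding s1 by (simp add: algebra_simps power2_eq_square power3_eq_cube)
  then have N1: "6 * l ^ 3 * N1 = 6 * l ^ 2 * ((q + 1) * (q ^ 3 - 1))
      - 2 * (6 * l ^ 3 * N2) - 3 * (6 * l ^ 3 * N3)"
    unfolding hl[symmetric] by (simp add: algebra_simps)
  have N0: "6 * l ^ 3 * N0 = 6 * l ^ 3 * (q ^ 4 - 1)
      - 6 * l ^ 3 * N1 - 6 * l ^ 3 * N2 - 6 * l ^ 3 * N3"
    unfolding s0[symmetric] by (simp add: algebra_simps)
  note N2' = N2[unfolded N3]
  note N1' = N1[unfolded N2' N3]
  note N0' = N0[unfolded N1' N2' N3]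
  have solve: "N = X / (c * l ^ 3)" if "6 * l ^ 3 * N = d * X" "d * c = 6" for N X c d :: real
  proof -
    have "d * (c * l ^ 3 * N) = d * X" using that by (simp flip: mult.assoc)
    then have "c * l ^ 3 * N = X" "c \<noteq> 0" using that(2) by auto
    then show ?thesis using l by (simp add: field_simps)
  qed
  show "N3 = (q ^ 2 - 1) * (q + 1 - 2 * l) * (q + 1 - l) / (6 * l ^ 3)"
    by (rule solve[where d = 1]; (unfold N3)?) (simp_all add: algebra_simps eval_nat_numeral)
  show "N2 = (q ^ 2 - 1) * ((q + 3) * l - q - 1) * (q + 1 - l) / (2 * l ^ 3)"
    by (rule solve[where d = 3]; (unfold N2')?) (simp_all add: algebra_simps eval_nat_numeral)
  show "N1 = (q ^ 2 - 1) * ((2 * q ^ 2 + 4 * q + 6) * l ^ 2 - (2 * q ^ 2 + 7 * q + 5) * l + (q + 1) ^ 2)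
          / (2 * l ^ 3)"
    by (rule solve[where d = 3]; (unfold N1')?) (simp_all add: algebra_simps eval_nat_numeral)
  show "N0 = (q ^ 2 - 1) * (6 * (q ^ 2 + 1) * l ^ 3 - (6 * q ^ 2 + 9 * q + 11) * l ^ 2
          + (3 * q ^ 2 + 9 * q + 6) * l - (q + 1) ^ 2) / (6 * l ^ 3)"
    by (rule solve[where d = 1]; (unfold N0')?) (simp_all add: algebra_simps eval_nat_numeral)
qed

section \<open>Two arithmetic facts about the parameters\<close>

lemma coprime_of_cong_minus_1:
  assumes "[int m = - 1] (mod int k)"
  shows "coprime k m"
proof -
  have dvd: "int k dvd int (m + 1)" using assms by (simp add: cong_iff_dvd_diff add.commute)
  then have "k dvd m + 1" by (simp only: int_dvd_int_iff)
  then have "gcd k m dvd m + 1" "gcd k m dvd m" using dvd_trans by auto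
  then have "gcd k m dvd 1" using dvd_add_right_iff by blast
  then show ?thesis by (simp only: nat_dvd_1_iff_1 coprime_iff_gcd_eq_1)
qed

text \<open>Since 2 is -1 modulo 3, \<open>2 ^ k\<close> is 1 or -1. This later rules out a subgroup
  of order 3.\<close>

lemma three_dvd_pow2: "(3::nat) dvd 2 ^ k - 1 \<or> (3::nat) dvd 2 ^ k + 1"
proof (induction k)
  case (Suc k)
  have "(2::nat) ^ k \<ge> 1" by simp
  then obtain r where r: "(2::nat) ^ k = Suc r" by (cases "(2::nat) ^ k") auto
  have "3 dvd 2 * r + 1 \<or> 3 dvd 2 * r + 3" using Suc r by simp presburger
  then show ?case using r by (simp add: numeral_3_eq_3)
qed simp

section \<open>The field with \<open>q ^ 2\<close> elements, its subfield and its unit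
  circle\<close>

locale even_degree_field =
  fixes m :: nat and F :: "'a::finite_field itself"
  assumes card: "CARD('a) = 2 ^ (2 * m)" and m_pos: "m > 0"
begin

abbreviation q :: nat where "q \<equiv> 2 ^ m"

definition U :: "'a set" where "U = {z. z ^ (q + 1) = 1}"
definition K :: "'a set" where "K = {y. y ^ q = y}"

lemma char: "CHAR('a) = 2"
  by (rule CHAR_eq_2[OF card])

lemma two_eq_0: "(2::'a) = 0"
  using of_nat_CHAR[where ?'a = 'a] char by simp

lemma uminus_eq: "- (x::'a) = x"
proof -
  have "x + x = 2 * x" by simp
  also have "\<dots> = 0" by (simp only: two_eq_0 mult_zero_left)
  finally show ?thesis using minus_unique by blast
qed

lemma minus_eq_plus: "(x::'a) - y = x + y"
  using diff_conv_add_uminus[of x y] unfolding uminus_eq .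

lemma add_power: "((x::'a) + y) ^ 2 ^ i = x ^ 2 ^ i + y ^ 2 ^ i"
  using freshmans_dream'[of "2 ^ i" i x y] char by simp

lemma diff_power: "((x::'a) - y) ^ 2 ^ i = x ^ 2 ^ i - y ^ 2 ^ i"
  unfolding minus_eq_plus by (rule add_power)

lemma power_qq: "((x::'a) ^ q) ^ q = x"
  using finite_field_power_card_eq_same[of x]
  by (simp add: card power_mult[symmetric] power_add[symmetric] mult_2)

lemma inj_power: "inj (\<lambda>x::'a. x ^ 2 ^ i)"
  by (rule injI) (metis diff_power eq_iff_diff_eq_0 power_eq_0_iff)

lemma card_minus_1: "CARD('a) - 1 = (q + 1) * (q - 1)"
  by (simp add: card mult_2 power_add diff_mult_distrib2 add_mult_distrib)

lemma card_U: "card U = q + 1"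
  unfolding U_def by (rule card_roots_of_unity[OF card_minus_1[symmetric]])

lemma card_Kx: "card (K - {0}) = q - 1"
proof -
  have "K - {0} = {y. y ^ (q - 1) = 1}"
  proof -
    have "y ^ q = y * y ^ (q - 1)" for y :: 'a
      using power_minus_mult[of q y] by (simp add: mult.commute)
    moreover have "q - 1 > 0" using one_less_power[of "2::nat" m] m_pos by simp
    ultimately show ?thesis by (auto simp: K_def power_0_left)
  qed
  then show ?thesis
    using card_roots_of_unity[of "q - 1" "q + 1", where ?'a = 'a] card_minus_1 by (simp add: mult.commute)
qed

lemma card_K: "card K = q"
proof -
  have "0 \<in> K" by (simp add: K_def)
  then show ?thesis using card_Kx card.remove[OF finite \<open>0 \<in> K\<close>]
    by (metis Suc_pred' One_nat_def diff_Suc_1 zero_less_power pos2 Suc_pred)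
qed

lemma U_nonzero: "z \<in> U \<Longrightarrow> z \<noteq> 0"
  by (auto simp: U_def)

lemma U_power_q: "z \<in> U \<Longrightarrow> z ^ q = inverse z"
proof -
  assume "z \<in> U"
  then have "z * z ^ q = 1" by (simp add: U_def)
  from inverse_unique[OF this] show ?thesis by simp
qed

lemma U_power:
  assumes "z \<in> U"
  shows "z ^ i \<in> U"
proof -
  have "(z ^ i) ^ (q + 1) = (z ^ (q + 1)) ^ i" by (simp only: mult.commute flip: power_mult)
  also have "\<dots> = 1" using assms unfolding U_def by (simp only: mem_Collect_eq power_one)
  finally show ?thesis unfolding U_def by (rule CollectI)
qed

lemma U_conj: "z \<in> U \<Longrightarrow> inverse z ^ q = z"
  using U_power_q power_inverse[of z q] by simp

section \<open>Fixed points of semilinear maps and the cross ratio\<close>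

text \<open>Iterating both power maps according to a Bezout relation
  \<open>m * x = k * y + 1\<close> shows that \<open>c\<close> is fixed by squaring.\<close>

lemma fixed_by_coprime_powers:
  fixes c :: 'a
  assumes "coprime k m" and k: "c ^ 2 ^ k = c" and q: "c ^ q = c"
  shows "c = 0 \<or> c = 1"
proof -
  have iter: "c ^ 2 ^ (j * i) = c" if "c ^ 2 ^ j = c" for i j
    by (induction i) (use that in \<open>simp_all add: power_add power_mult\<close>)
  obtain x y where xy: "m * x = k * y + 1"
    using bezout_nat[of m k] m_pos \<open>coprime k m\<close> by (auto simp: gcd.commute)
  have "c = c ^ 2 ^ (m * x)" using iter[OF q] by simp
  also have "\<dots> = (c ^ 2 ^ (k * y)) ^ 2"
    unfolding xy power_add power_one_right by (rule power_mult)
  also have "\<dots> = c ^ 2" using iter[OF k] by simp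
  finally have "c * (c - 1) = 0" by (simp add: power2_eq_square algebra_simps)
  then show ?thesis by simp
qed

text \<open>For solutions \<open>x, y\<close> one has \<open>(x - y) ^ 2 ^ k * (p x * p y) = D * (x - y)\<close> with
  \<open>p v = b' * v + a'\<close> and \<open>D\<close> the determinant. Hence the cross ratio of four solutions is fixed by
  the \<open>2 ^ k\<close>-th power map; on the unit circle it is also fixed by the \<open>2 ^ m\<close>-th power map, so it
  lies in the prime field, which is impossible for distinct points.\<close>

lemma semilinear_fixed_points:
  assumes cop: "coprime k m" and dist: "distinct [v1, v2, v3, v4]"
    and U: "{v1, v2, v3, v4} \<subseteq> U"
    and eq: "\<And>v. v \<in> {v1, v2, v3, v4} \<Longrightarrow> v ^ 2 ^ k * (b' * v + a') = a * v + b"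
  shows "a' = 0 \<and> b' = 0"
proof -
  define D where "D = a * a' - b * b'"
  define p where "p v = b' * v + a'" for v
  have diff: "(x - y) ^ 2 ^ k * (p x * p y) = D * (x - y)"
    if "x \<in> {v1, v2, v3, v4}" "y \<in> {v1, v2, v3, v4}" for x y
  proof -
    have "(x - y) ^ 2 ^ k * (p x * p y) = (x ^ 2 ^ k * p x) * p y - (y ^ 2 ^ k * p y) * p x"
      by (simp add: diff_power algebra_simps)
    also have "\<dots> = (a * x + b) * p y - (a * y + b) * p x"
      using eq[OF that(1)] eq[OF that(2)] by (simp add: p_def)
    also have "\<dots> = D * (x - y)" by (simp add: D_def p_def algebra_simps)
    finally show ?thesis .
  qed
  show ?thesis
  proof (cases "D = 0")
    case True
    \<comment> \<open>With \<open>D = 0\<close>, among any two distinct solutions one is a zero of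
      \<open>p\<close>. So \<open>p\<close> vanishes at two of three points, which forces an affine
      function to be zero.\<close>
    have pp: "p x = 0 \<or> p y = 0" if "x \<in> {v1, v2, v3, v4}" "y \<in> {v1, v2, v3, v4}" "x \<noteq> y" for x y
      using diff[OF that(1,2)] True that(3) by auto
    have two: "a' = 0 \<and> b' = 0" if "p x = 0" "p y = 0" "x \<noteq> y" for x y
    proof -
      have "b' * (x - y) = p x - p y" by (simp add: p_def algebra_simps)
      then have "b' = 0" using that by simp
      then show ?thesis using that(1) by (simp add: p_def)
    qed
    show ?thesis
      using pp[of v1 v2] pp[of v1 v3] pp[of v2 v3] two[of v1 v2] two[of v1 v3] two[of v2 v3] dist
      by auto
  next
    case False
    have p0: "p x \<noteq> 0" if x: "x \<in> {v1, v2, v3, v4}" for x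
    proof -
      obtain y where "y \<in> {v1, v2, v3, v4}" "y \<noteq> x" using dist by auto
      then show ?thesis using diff[OF x] False by force
    qed
    \<comment> \<open>\<open>N / M\<close> is the cross ratio. Each of the four points occurs once
      in \<open>N\<close> and once in \<open>M\<close>, so the factors \<open>P\<close> and
      \<open>V\<close> produced by the two power maps are common to both and cancel.\<close>
    define N where "N = (v1 - v3) * (v2 - v4)"
    define M where "M = (v1 - v4) * (v2 - v3)"
    define P where "P = p v1 * p v2 * p v3 * p v4"
    define V where "V = v1 * v2 * v3 * v4"
    have nz: "N \<noteq> 0" "M \<noteq> 0" "P \<noteq> 0" "V \<noteq> 0"
      using dist p0 U U_nonzero by (auto simp: N_def M_def P_def V_def)
    have "N ^ 2 ^ k * P = ((v1 - v3) ^ 2 ^ k * (p v1 * p v3)) * ((v2 - v4) ^ 2 ^ k * (p v2 * p v4))"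
      by (simp only: N_def P_def power_mult_distrib mult_ac)
    also have "\<dots> = (D * (v1 - v3)) * (D * (v2 - v4))"
      by (simp only: diff insert_iff simp_thms)
    finally have N: "N ^ 2 ^ k * P = D\<^sup>2 * N"
      by (simp only: N_def power2_eq_square mult_ac)
    have "M ^ 2 ^ k * P = ((v1 - v4) ^ 2 ^ k * (p v1 * p v4)) * ((v2 - v3) ^ 2 ^ k * (p v2 * p v3))"
      by (simp only: M_def P_def power_mult_distrib mult_ac)
    also have "\<dots> = (D * (v1 - v4)) * (D * (v2 - v3))"
      by (simp only: diff insert_iff simp_thms)
    finally have M: "M ^ 2 ^ k * P = D\<^sup>2 * M"
      by (simp only: M_def power2_eq_square mult_ac)
    have conj: "(x - y) ^ q * (x * y) = y - x" if "x \<in> U" "y \<in> U" for x y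
      using U_power_q[OF that(1)] U_power_q[OF that(2)] U_nonzero[OF that(1)] U_nonzero[OF that(2)]
      by (simp add: diff_power field_simps)
    have "N ^ q * V = ((v1 - v3) ^ q * (v1 * v3)) * ((v2 - v4) ^ q * (v2 * v4))"
      by (simp only: N_def V_def power_mult_distrib mult_ac)
    also have "\<dots> = (v3 - v1) * (v4 - v2)"
      using conj[of v1 v3] conj[of v2 v4] U by simp
    finally have Nq: "N ^ q * V = N" by (simp add: N_def algebra_simps)
    have "M ^ q * V = ((v1 - v4) ^ q * (v1 * v4)) * ((v2 - v3) ^ q * (v2 * v3))"
      by (simp only: M_def V_def power_mult_distrib mult_ac)
    also have "\<dots> = (v4 - v1) * (v3 - v2)"
      using conj[of v1 v4] conj[of v2 v3] U by simp
    finally have Mq: "M ^ q * V = M" by (simp add: M_def algebra_simps)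
    have "(N / M) ^ 2 ^ k = (N ^ 2 ^ k * P) / (M ^ 2 ^ k * P)"
      using nz by (simp add: power_divide)
    also have "\<dots> = N / M" using N M nz False by simp
    finally have k: "(N / M) ^ 2 ^ k = N / M" .
    have "(N / M) ^ q = (N ^ q * V) / (M ^ q * V)"
      using nz by (simp add: power_divide)
    also have "\<dots> = N / M" using Nq Mq by simp
    finally have "N / M = 0 \<or> N / M = 1"
      using fixed_by_coprime_powers[OF cop k] by blast
    then have "N = M" using nz by simp
    \<comment> \<open>This product is exactly \<open>N - M\<close>.\<close>
    then have "(v1 - v2) * (v3 - v4) = 0" by (simp add: N_def M_def algebra_simps)
    then show ?thesis using dist by simp
  qed
qed

section \<open>The form on the unit circle and its annihilators\<close>

text \<open>This is \<open>c + c ^ q\<close> for \<open>c = a / w ^ (2 ^ k - 1) + b / w ^ (2 ^ k + 1)\<close> with \<open>w\<close> on the unit circle,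
  where \<open>w ^ q = inverse w\<close>.\<close>

definition niho_form :: "nat \<Rightarrow> 'a \<times> 'a \<Rightarrow> 'a \<Rightarrow> 'a" where
  "niho_form k p w = fst p * inverse w ^ (2 ^ k - 1) + fst p ^ q * w ^ (2 ^ k - 1)
    + snd p * inverse w ^ (2 ^ k + 1) + snd p ^ q * w ^ (2 ^ k + 1)"

lemma niho_form_diff: "niho_form k (p - p') w = niho_form k p w - niho_form k p' w"
  by (simp add: niho_form_def diff_power algebra_simps)

text \<open>The \<open>q\<close>-th power inverts \<open>w\<close>, hence swaps the two terms of
  each conjugate pair and fixes their sum.\<close>

lemma niho_form_in_K:
  assumes "w \<in> U"
  shows "niho_form k p w \<in> K"
proof -
  have conj: "(inverse w ^ i) ^ q = w ^ i" "(w ^ i) ^ q = inverse w ^ i" for i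
    using U_conj[OF assms] U_power_q[OF assms]
    by (simp_all only: power_mult[symmetric] mult.commute[of i]) (simp_all only: power_mult)
  define i j :: nat where "i = 2 ^ k - 1" and "j = 2 ^ k + 1"
  show ?thesis
    unfolding K_def niho_form_def i_def[symmetric] j_def[symmetric]
    by (simp add: add_power power_mult_distrib power_qq conj add_ac)
qed

text \<open>Multiplication by \<open>w ^ (2 ^ k + 1)\<close> makes every exponent even, which leaves
  a relation in \<open>v = w\<^sup>2\<close> of the shape required by
  \<open>semilinear_fixed_points\<close>.\<close>

lemma niho_form_eq_0:
  assumes w: "w \<in> U" and 0: "niho_form k (a, b) w = 0"
  shows "(w\<^sup>2) ^ 2 ^ k * (b ^ q * w\<^sup>2 + a ^ q) = a * w\<^sup>2 + b"
proof -
  \<comment> \<open>Thus \<open>r = 2 ^ k - 1\<close>, and the multiplier \<open>w ^ (r + 2)\<close>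
    is \<open>w ^ (2 ^ k + 1)\<close>.\<close>
  obtain r where r: "(2::nat) ^ k = Suc r" by (metis gr0_implies_Suc zero_less_power pos2)
  have inv: "inverse w ^ i * w ^ i = 1" for i
    using U_nonzero[OF w] by (simp flip: power_mult_distrib)
  have 1: "inverse w ^ (2 ^ k - 1) * w ^ (r + 2) = w\<^sup>2"
    using inv[of r] by (simp add: r mult.left_commute power2_eq_square)
  have 2: "inverse w ^ (2 ^ k + 1) * w ^ (r + 2) = 1"
    using inv[of "r + 2"] by (simp add: r)
  have 3: "w ^ (2 ^ k - 1) * w ^ (r + 2) = (w\<^sup>2) ^ 2 ^ k"
    "w ^ (2 ^ k + 1) * w ^ (r + 2) = (w\<^sup>2) ^ 2 ^ k * w\<^sup>2"
    by (simp_all add: r mult_2 flip: power_mult power_add)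
  have "0 = niho_form k (a, b) w * w ^ (r + 2)" using 0 by simp
  also have "\<dots> = a * (inverse w ^ (2 ^ k - 1) * w ^ (r + 2)) + a ^ q * (w ^ (2 ^ k - 1) * w ^ (r + 2))
      + b * (inverse w ^ (2 ^ k + 1) * w ^ (r + 2)) + b ^ q * (w ^ (2 ^ k + 1) * w ^ (r + 2))"
    by (simp only: niho_form_def fst_conv snd_conv distrib_right mult.assoc)
  also have "\<dots> = (w\<^sup>2) ^ 2 ^ k * (b ^ q * w\<^sup>2 + a ^ q) + (a * w\<^sup>2 + b)"
    unfolding 1 2 3 by (simp add: algebra_simps)
  finally show ?thesis by (metis minus_eq_plus right_minus_eq)
qed

definition annihilator :: "nat \<Rightarrow> 'a set \<Rightarrow> ('a \<times> 'a) set" where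
  "annihilator k S = {p. \<forall>w\<in>S. niho_form k p w = 0}"

text \<open>Squaring is injective in characteristic 2, so the squares of the four points are four
  distinct solutions on \<open>U\<close>, and the cross ratio lemma makes both \<open>a ^ q\<close>
  and \<open>b ^ q\<close> vanish.\<close>

lemma annihilator_four_points:
  assumes "coprime k m" "S \<subseteq> U" "card S = 4"
  shows "annihilator k S = {(0, 0)}"
proof -
  have "(0, 0) \<in> annihilator k S" by (simp add: annihilator_def niho_form_def power_0_left)
  moreover have "a = 0 \<and> b = 0" if ab: "(a, b) \<in> annihilator k S" for a b
  proof -
    obtain w1 w2 w3 w4 where S: "S = {w1, w2, w3, w4}" "distinct [w1, w2, w3, w4]"
      using \<open>card S = 4\<close> by (auto simp: card_Suc_eq numeral_eq_Suc)
    have "x\<^sup>2 = y\<^sup>2 \<longleftrightarrow> x = y" for x y :: 'a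
      using inj_eq[OF inj_power[of 1]] by simp
    then have "distinct [w1\<^sup>2, w2\<^sup>2, w3\<^sup>2, w4\<^sup>2]" using S(2) by simp
    moreover have "{w1\<^sup>2, w2\<^sup>2, w3\<^sup>2, w4\<^sup>2} \<subseteq> U" using U_power S \<open>S \<subseteq> U\<close> by auto
    moreover have "v ^ 2 ^ k * (b ^ q * v + a ^ q) = a * v + b" if v: "v \<in> {w1\<^sup>2, w2\<^sup>2, w3\<^sup>2, w4\<^sup>2}" for v
    proof -
      obtain w where "w \<in> S" "v = w\<^sup>2" using v S by auto
      then show ?thesis using niho_form_eq_0[of w k a b] ab \<open>S \<subseteq> U\<close> by (auto simp: annihilator_def)
    qed
    ultimately have "a ^ q = 0 \<and> b ^ q = 0" by (rule semilinear_fixed_points[OF assms(1)])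
    then show ?thesis by simp
  qed
  ultimately show ?thesis by fast
qed

text \<open>Each new point imposes one additive condition with values in \<open>K\<close>, so it
  shrinks the annihilator by a factor of at most \<open>q\<close>.\<close>

lemma card_annihilator_Un:
  assumes "finite R" "R \<subseteq> U"
  shows "card (annihilator k S) \<le> q ^ card R * card (annihilator k (S \<union> R))"
  using assms
proof (induction R rule: finite_induct)
  case (insert w R)
  have "card (annihilator k (S \<union> R)) \<le> card K * card {p \<in> annihilator k (S \<union> R). niho_form k p w = 0}"
    using niho_form_in_K[of w k] insert.prems niho_form_diff
    by (intro additive_card_le[of _ "\<lambda>p. niho_form k p w"]) (auto simp: annihilator_def)
  also have "{p \<in> annihilator k (S \<union> R). niho_form k p w = 0} = annihilator k (S \<union> insert w R)"
    by (auto simp: annihilator_def)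
  finally have "card (annihilator k (S \<union> R)) \<le> q * card (annihilator k (S \<union> insert w R))"
    by (simp add: card_K)
  then have "q ^ card R * card (annihilator k (S \<union> R)) \<le> q ^ card R * (q * card (annihilator k (S \<union> insert w R)))"
    by (rule mult_left_mono) simp
  moreover have "card (annihilator k S) \<le> q ^ card R * card (annihilator k (S \<union> R))"
    using insert by simp
  ultimately show ?case using insert.hyps by (auto simp: mult_ac intro: order_trans)
qed simp

text \<open>Each further point costs at most a factor \<open>q\<close>; since four points bring \<open>q ^ 4\<close> pairs down to
  one, each of them costs exactly \<open>q\<close>.\<close>

lemma card_annihilator:
  assumes "coprime k m" "m \<ge> 2" "S \<subseteq> U" "card S \<le> 4"
  shows "card (annihilator k S) = q ^ (4 - card S)"
proof (rule antisym)
  have finU: "finite U" by simp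
  \<comment> \<open>From \<open>m \<ge> 2\<close> the circle \<open>U\<close> has at least five
    points, enough to extend \<open>S\<close> to four points.\<close>
  have "(4::nat) \<le> q" using power_increasing[OF \<open>m \<ge> 2\<close>, of "2::nat"] by simp
  then have "4 - card S \<le> card (U - S)"
    using card_U \<open>S \<subseteq> U\<close> finU by (simp add: card_Diff_subset finite_subset)
  then obtain R where R: "R \<subseteq> U - S" "card R = 4 - card S" "finite R"
    by (rule obtain_subset_with_card_n)
  have "card (S \<union> R) = 4"
    using R \<open>card S \<le> 4\<close> by (subst card_Un_disjoint) auto
  then have "annihilator k (S \<union> R) = {(0, 0)}" using R assms by (intro annihilator_four_points) auto
  then show "card (annihilator k S) \<le> q ^ (4 - card S)"
    using card_annihilator_Un[of R k S] R by auto
  have "card (annihilator k {}) = q ^ 4"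
    using card
    by (simp add: annihilator_def UNIV_Times_UNIV[symmetric] card_cartesian_product del: UNIV_Times_UNIV
        flip: power_mult power_add)
  then have "q ^ 4 \<le> q ^ card S * card (annihilator k S)"
    using card_annihilator_Un[of S k "{}"] \<open>S \<subseteq> U\<close> by simp
  moreover have "q ^ 4 = q ^ card S * q ^ (4 - card S)"
    using \<open>card S \<le> 4\<close> by (simp flip: power_add)
  ultimately show "q ^ (4 - card S) \<le> card (annihilator k S)" by simp
qed

section \<open>Trace sums and the polar decomposition\<close>

text \<open>Transitivity of the trace through \<open>K\<close>: the exponents from \<open>m\<close>
  on repeat the first \<open>m\<close> with \<open>A ^ q\<close> in place of \<open>A\<close>, as
  \<open>y\<close> is fixed by the \<open>q\<close>-th power.\<close>

lemma abs_trace_K_mult: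
  assumes "y \<in> K"
  shows "abs_trace (2 * m) (y * A) = (\<Sum>i<m. (y * (A + A ^ q)) ^ 2 ^ i)"
proof -
  have split: "(\<Sum>i<m + r. f i) = (\<Sum>i<m. f i) + (\<Sum>i<r. f (m + i))" for f :: "nat \<Rightarrow> 'a" and r
    by (induction r) (simp_all add: add.assoc)
  have "abs_trace (2 * m) (y * A) = (\<Sum>i<m. (y * A) ^ 2 ^ i) + (\<Sum>i<m. ((y * A) ^ q) ^ 2 ^ i)"
    unfolding abs_trace_def mult_2 split by (simp only: power_add power_mult)
  also have "(y * A) ^ q = y * A ^ q" using assms by (simp add: K_def power_mult_distrib)
  finally show ?thesis
    by (simp add: distrib_left add_power flip: sum.distrib)
qed

lemma abs_trace_add: "abs_trace r (x + y :: 'a) = abs_trace r x + abs_trace r y"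
  by (simp add: abs_trace_def add_power sum.distrib)

lemma sign_F2_add:
  fixes u v :: 'a
  assumes "u \<in> {0, 1}" "v \<in> {0, 1}"
  shows "sign_F2 (u + v) = sign_F2 u * sign_F2 v"
  using assms two_eq_0 by (auto simp: sign_F2_def)

text \<open>As a polynomial in \<open>y\<close> the sum has linear coefficient \<open>B\<close> and
  degree at most \<open>2 ^ (m - 1) < q\<close>, so it cannot vanish on all \<open>q\<close>
  elements of \<open>K\<close>.\<close>

lemma exists_nonzero_trace:
  assumes "B \<noteq> 0"
  shows "\<exists>y\<in>K. (\<Sum>i<m. (y * B) ^ 2 ^ i) \<noteq> 0"
proof (rule ccontr)
  assume none: "\<not> ?thesis"
  define p where "p = (\<Sum>i<m. monom (B ^ 2 ^ i) (2 ^ i))"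
  have "coeff p 1 = (\<Sum>i<m. if i = 0 then B ^ 2 ^ i else 0)"
    unfolding p_def coeff_sum by (intro sum.cong) auto
  then have "coeff p 1 = B" using m_pos by (simp add: sum.delta)
  then have "p \<noteq> 0" using assms by auto
  have "poly p y = (\<Sum>i<m. (y * B) ^ 2 ^ i)" for y
    by (simp add: p_def poly_sum poly_monom power_mult_distrib mult.commute)
  then have "K \<subseteq> {y. poly p y = 0}" using none by auto
  then have "q \<le> card {y. poly p y = 0}"
    using card_mono[of "{y. poly p y = 0}" K] card_K by simp
  also have "\<dots> \<le> degree p" by (rule card_poly_roots_bound[OF \<open>p \<noteq> 0\<close>])
  also have "\<dots> \<le> 2 ^ (m - 1)"
    unfolding p_def
  proof (intro degree_sum_le)
    fix i assume "i \<in> {..<m}"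
    then have "(2::nat) ^ i \<le> 2 ^ (m - 1)" by (intro power_increasing) auto
    then show "degree (monom (B ^ 2 ^ i) (2 ^ i)) \<le> 2 ^ (m - 1)"
      using degree_monom_le order_trans by blast
  qed simp
  also have "\<dots> < q" using m_pos by (intro power_strict_increasing) auto
  finally show False by simp
qed

text \<open>Orthogonality of characters: if some \<open>y0\<close> has nonzero trace, translating by
  it negates the sum; otherwise all terms are 1.\<close>

lemma sum_sign_trace_K:
  "(\<Sum>y\<in>K. sign_F2 (abs_trace (2 * m) (y * A))) = (if A + A ^ q = 0 then int q else 0)"
proof (cases "A + A ^ q = 0")
  case True
  then show ?thesis
    using abs_trace_K_mult[of _ A] card_K by (simp add: sign_F2_def power_0_left)
next
  case False
  let ?t = "\<lambda>y. abs_trace (2 * m) (y * A)"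
  obtain y0 where y0: "y0 \<in> K" "?t y0 \<noteq> 0"
    using exists_nonzero_trace[OF False] abs_trace_K_mult[of _ A] by auto
  have "(\<Sum>y\<in>K. sign_F2 (?t y)) = (\<Sum>y\<in>K. sign_F2 (?t (y + y0)))"
    by (rule sum.reindex_bij_witness[of _ "\<lambda>y. y + y0" "\<lambda>y. y - y0"])
      (use y0 in \<open>auto simp: K_def add_power diff_power\<close>)
  also have "\<dots> = (\<Sum>y\<in>K. sign_F2 (?t y) * sign_F2 (?t y0))"
    unfolding distrib_right abs_trace_add
    using abs_trace_in_F2[OF card] by (intro sum.cong sign_F2_add) auto
  also have "\<dots> = - (\<Sum>y\<in>K. sign_F2 (?t y))"
    using y0 by (simp add: sign_F2_def sum_negf)
  finally show ?thesis using False by simp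
qed

text \<open>Comparing \<open>y * z\<close> with its \<open>q\<close>-th power \<open>y / z\<close>
  determines \<open>z\<^sup>2\<close>, hence \<open>z\<close> and then \<open>y\<close>.
  Surjectivity follows from the count \<open>(q - 1) * (q + 1)\<close>.\<close>

lemma bij_polar: "bij_betw (\<lambda>(y, z). y * z) ((K - {0}) \<times> U) (- {0})"
proof -
  have "inj_on (\<lambda>(y, z). y * z) ((K - {0}) \<times> U)"
  proof (rule inj_onI)
    fix x x' assume x: "x \<in> (K - {0}) \<times> U" "x' \<in> (K - {0}) \<times> U"
      and eq_x: "(case x of (y, z) \<Rightarrow> y * z) = (case x' of (y, z) \<Rightarrow> y * z)"
    obtain y z y' z' where xyz: "x = (y, z)" "x' = (y', z')" by fastforce
    then have yz: "y \<in> K" "y \<noteq> 0" "z \<in> U" "y' \<in> K" "y' \<noteq> 0" "z' \<in> U"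
      and eq: "y * z = y' * z'" using x eq_x by auto
    have "(y * z) ^ q = (y' * z') ^ q" using eq by simp
    then have "y * inverse z = y' * inverse z'"
      using yz by (simp add: K_def power_mult_distrib U_power_q)
    with eq have "(y * z) * (y' * inverse z') = (y' * z') * (y * inverse z)" by simp
    then have "z\<^sup>2 = z'\<^sup>2"
      using yz U_nonzero[of z] U_nonzero[of z'] by (simp add: field_simps power2_eq_square)
    then have "z = z'" using injD[OF inj_power[of 1]] by simp
    then show "x = x'" using eq yz xyz U_nonzero by simp
  qed
  moreover have "card ((K - {0}) \<times> U) = card (- {0::'a})"
    using card_minus_1 by (simp add: card_cartesian_product card_Kx card_U Compl_eq_Diff_UNIV
        card_Diff_subset mult.commute)
  moreover have "(\<lambda>(y, z). y * z) ` ((K - {0}) \<times> U) \<subseteq> - {0}"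
    using U_nonzero by auto
  ultimately show ?thesis
    by (simp add: bij_betw_def card_subset_eq card_image)
qed

text \<open>Both exponents are 1 modulo \<open>q - 1\<close>, so a factor \<open>y\<close> in
  \<open>K\<close> comes out linearly and the sum over \<open>y\<close> is a trace sum.\<close>

lemma T1_eq_count:
  fixes a b :: 'a
  assumes d1: "d1 = s1 * (q - 1) + 1" and d2: "d2 = s2 * (q - 1) + 1"
  defines "A \<equiv> \<lambda>z. a * z ^ d1 + b * z ^ d2"
  shows "T1 (2 * m) d1 d2 a b = int q * int (card {z \<in> U. A z + A z ^ q = 0}) - int q"
proof -
  let ?s = "\<lambda>x. sign_F2 (abs_trace (2 * m) x)"
  have zero: "?s 0 = 1" by (simp add: sign_F2_def abs_trace_def power_0_left)
  have pow: "(y * z) ^ (s * (q - 1) + 1) = y * z ^ (s * (q - 1) + 1)" if "y \<in> K" "y \<noteq> 0" for y z s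
  proof -
    have "y * y ^ (q - 1) = y * 1"
      using that power_minus_mult[of q y] by (simp add: K_def mult.commute)
    then have "y ^ (q - 1) = 1" using that by simp
    then have "y ^ (s * (q - 1)) = 1" by (metis mult.commute power_mult power_one)
    then show ?thesis by (simp add: power_mult_distrib)
  qed
  have A: "A (y * z) = y * A z" if "y \<in> K" "y \<noteq> 0" for y z
    unfolding A_def d1 d2 pow[OF that] by (simp add: algebra_simps)
  have "A 0 = 0" by (simp add: A_def d1 d2)
  have "T1 (2 * m) d1 d2 a b = (\<Sum>x\<in>UNIV. ?s (A x))"
    by (simp add: T1_def A_def)
  also have "\<dots> = 1 + (\<Sum>x\<in>- {0}. ?s (A x))"
    using sum.remove[of UNIV 0 "\<lambda>x. ?s (A x)"] zero \<open>A 0 = 0\<close> by (simp add: Compl_eq_Diff_UNIV)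
  also have "(\<Sum>x\<in>- {0}. ?s (A x)) = (\<Sum>(y, z)\<in>(K - {0}) \<times> U. ?s (A (y * z)))"
    by (subst sum.reindex_bij_betw[OF bij_polar, symmetric]) (simp add: case_prod_unfold)
  also have "\<dots> = (\<Sum>(y, z)\<in>(K - {0}) \<times> U. ?s (y * A z))"
  proof (rule sum.cong[OF refl])
    fix x assume "x \<in> (K - {0}) \<times> U"
    then obtain y z where "x = (y, z)" "y \<in> K" "y \<noteq> 0" by auto
    then show "(case x of (y, z) \<Rightarrow> ?s (A (y * z))) = (case x of (y, z) \<Rightarrow> ?s (y * A z))"
      by (simp add: A)
  qed
  also have "\<dots> = (\<Sum>y\<in>K - {0}. \<Sum>z\<in>U. ?s (y * A z))"
    by (simp add: sum.cartesian_product)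
  also have "\<dots> = (\<Sum>z\<in>U. \<Sum>y\<in>K - {0}. ?s (y * A z))"
    by (rule sum.swap)
  \<comment> \<open>The missing \<open>y = 0\<close> costs 1 for each of the \<open>q + 1\<close>
    points \<open>z\<close>; with the term 1 from \<open>x = 0\<close> this leaves
    \<open>- q\<close>.\<close>
  also have "\<dots> = (\<Sum>z\<in>U. (if A z + A z ^ q = 0 then int q else 0) - 1)"
  proof (rule sum.cong[OF refl])
    fix z
    have "0 \<in> K" by (simp add: K_def power_0_left)
    then show "(\<Sum>y\<in>K - {0}. ?s (y * A z)) = (if A z + A z ^ q = 0 then int q else 0) - 1"
      using sum.remove[of K 0 "\<lambda>y. ?s (y * A z)"] sum_sign_trace_K[of "A z"] zero by simp
  qed
  also have "\<dots> = int q * int (card {z \<in> U. A z + A z ^ q = 0}) - int (card U)"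
    by (simp add: sum_subtractf sum.If_cases Int_def mult.commute)
  finally show ?thesis by (simp add: card_U)
qed

text \<open>Exponents on \<open>U\<close> count modulo \<open>q + 1\<close>, where
  \<open>q - 1\<close> is -2, so \<open>s * (q - 1) + 1\<close> becomes
  \<open>1 - 2 * s = - (e * t)\<close>.\<close>

lemma U_power_half:
  assumes z: "z \<in> U" and s: "2 * s = e * t + 1"
  shows "z ^ (s * (q - 1) + 1) = inverse (z ^ t) ^ e"
proof -
  have "s * (q - 1) + 1 + t * e = s * (q - 1) + 2 * s" using s by (simp add: mult.commute)
  also have "\<dots> = (q + 1) * s" by (cases q) (simp_all add: algebra_simps)
  finally have "z ^ (s * (q - 1) + 1) * (z ^ t) ^ e = z ^ ((q + 1) * s)"
    by (simp only: power_add[symmetric] power_mult[symmetric])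
  also have "\<dots> = (z ^ (q + 1)) ^ s" by (rule power_mult)
  also have "\<dots> = 1" using z by (simp only: U_def mem_Collect_eq power_one)
  finally show ?thesis
    using inverse_unique by (metis inverse_inverse_eq power_inverse)
qed

lemma T1_eq_niho_form_count:
  assumes d1: "d1 = s1 * (q - 1) + 1" and d2: "d2 = s2 * (q - 1) + 1"
    and s1: "2 * s1 = (2 ^ k - 1) * t + 1" and s2: "2 * s2 = (2 ^ k + 1) * t + 1"
  shows "T1 (2 * m) d1 d2 a b = int q * int (card {z \<in> U. niho_form k (a, b) (z ^ t) = 0}) - int q"
proof -
  have "(a * z ^ d1 + b * z ^ d2) + (a * z ^ d1 + b * z ^ d2) ^ q = niho_form k (a, b) (z ^ t)"
    if "z \<in> U" for z
  proof -
    define i j :: nat where "i = 2 ^ k - 1" and "j = 2 ^ k + 1"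
    define w where "w = z ^ t"
    have "w \<in> U" using U_power[OF that] by (simp add: w_def)
    have conj: "(inverse w ^ r) ^ q = w ^ r" for r
      using U_conj[OF \<open>w \<in> U\<close>] by (metis mult.commute power_mult)
    have "z ^ d1 = inverse w ^ i" "z ^ d2 = inverse w ^ j"
      unfolding d1 d2 w_def i_def j_def using U_power_half[OF that s1] U_power_half[OF that s2] by auto
    then show ?thesis
      unfolding niho_form_def i_def[symmetric] j_def[symmetric] w_def[symmetric]
      by (simp add: add_power power_mult_distrib conj add_ac)
  qed
  then have "{z \<in> U. (a * z ^ d1 + b * z ^ d2) + (a * z ^ d1 + b * z ^ d2) ^ q = 0}
      = {z \<in> U. niho_form k (a, b) (z ^ t) = 0}" by auto
  then show ?thesis using T1_eq_count[OF d1 d2, of a b] by simp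
qed

section \<open>The \<open>t\<close>-th power map on the unit circle\<close>

lemma U_mult: "x \<in> U \<Longrightarrow> y \<in> U \<Longrightarrow> x * y \<in> U"
  unfolding U_def by (simp only: mem_Collect_eq power_mult_distrib mult_1)

lemma U_divide: "x \<in> U \<Longrightarrow> y \<in> U \<Longrightarrow> x / y \<in> U"
  unfolding U_def by (simp only: mem_Collect_eq power_divide div_by_1)

text \<open>Fibres are cosets of the kernel. By Bezout the kernel consists of the roots of unity of
  order dividing \<open>gcd t (q + 1)\<close>, a divisor of \<open>CARD('a) - 1\<close>.\<close>

lemma card_power_fibre:
  assumes "t > 0" and c: "c \<in> (\<lambda>z. z ^ t) ` U"
  shows "card {z \<in> U. z ^ t = c} = gcd t (q + 1)"
proof -
  define l where "l = gcd t (q + 1)"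
  obtain z0 where z0: "z0 \<in> U" "c = z0 ^ t" using c by auto
  have nz: "z0 \<noteq> 0" using U_nonzero z0 by simp
  have "bij_betw (\<lambda>z. z * z0) {z \<in> U. z ^ t = 1} {z \<in> U. z ^ t = c}"
    by (rule bij_betw_byWitness[where f' = "\<lambda>z. z / z0"])
      (use nz z0 U_mult U_divide in \<open>auto simp: power_mult_distrib power_divide\<close>)
  from bij_betw_same_card[OF this]
  have "card {z \<in> U. z ^ t = c} = card {z \<in> U. z ^ t = 1}" by (rule sym)
  also have "{z \<in> U. z ^ t = 1} = {z. z ^ l = 1}"
  proof (intro equalityI subsetI)
    fix z assume "z \<in> {z \<in> U. z ^ t = 1}"
    then have z: "z ^ (q + 1) = 1" "z ^ t = 1" unfolding U_def by blast+
    obtain x y where xy: "t * x = (q + 1) * y + l"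
      using bezout_nat[of t "q + 1"] \<open>t > 0\<close> by (auto simp: l_def)
    have "1 = z ^ (t * x)" unfolding power_mult z by simp
    also have "\<dots> = (z ^ (q + 1)) ^ y * z ^ l" unfolding xy by (simp only: power_add power_mult)
    also have "\<dots> = z ^ l" unfolding z(1) by simp
    finally show "z \<in> {z. z ^ l = 1}" by simp
  next
    fix z :: 'a assume "z \<in> {z. z ^ l = 1}"
    then have z: "z ^ l = 1" by simp
    have dvd: "z ^ i = 1" if "l dvd i" for i using that z by (auto simp: power_mult)
    have "z ^ (q + 1) = 1" "z ^ t = 1"
      by (rule dvd, unfold l_def, rule gcd_dvd2, rule dvd, unfold l_def, rule gcd_dvd1)
    then show "z \<in> {z \<in> U. z ^ t = 1}" unfolding U_def by blast
  qed
  also have "card \<dots> = l"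
  proof (rule card_roots_of_unity)
    show "l * ((q + 1) div l * (q - 1)) = CARD('a) - 1"
      unfolding card_minus_1 by (simp add: l_def flip: mult.assoc)
  qed
  finally show ?thesis by (simp add: l_def)
qed

lemma card_power_preimage:
  assumes "t > 0"
  shows "card {z \<in> U. P (z ^ t)} = gcd t (q + 1) * card {w \<in> (\<lambda>z. z ^ t) ` U. P w}"
proof -
  have "card {z \<in> U. P (z ^ t)}
      = (\<Sum>c\<in>(\<lambda>z. z ^ t) ` {z \<in> U. P (z ^ t)}. card {z \<in> {z \<in> U. P (z ^ t)}. z ^ t = c})"
    by (rule card_eq_sum_fibres) simp
  also have "\<dots> = (\<Sum>c\<in>{w \<in> (\<lambda>z. z ^ t) ` U. P w}. gcd t (q + 1))"
  proof (rule sum.cong)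
    fix c assume c: "c \<in> {w \<in> (\<lambda>z. z ^ t) ` U. P w}"
    then have "{z \<in> {z \<in> U. P (z ^ t)}. z ^ t = c} = {z \<in> U. z ^ t = c}" by auto
    then show "card {z \<in> {z \<in> U. P (z ^ t)}. z ^ t = c} = gcd t (q + 1)"
      using card_power_fibre[OF assms] c by simp
  qed auto
  finally show ?thesis by simp
qed

section \<open>Moments and the value distribution\<close>

text \<open>\<open>N0\<close> to \<open>N3\<close> count the nonzero pairs by their number of zeros.
  The zero pair has \<open>h\<close> zeros; its share \<open>h choose j\<close> is added on the
  left, which avoids subtraction of naturals.\<close>

lemma T1_value_distribution:
  assumes cop: "coprime k m" and m: "m \<ge> 2" and t: "t > 0"
    and l: "l = gcd t (q + 1)"
    and nz1: "\<not> q + 1 dvd (2 ^ k - 1) * t" and nz2: "\<not> q + 1 dvd (2 ^ k + 1) * t"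
    and d1: "d1 = s1 * (q - 1) + 1" and d2: "d2 = s2 * (q - 1) + 1"
    and s1: "2 * s1 = (2 ^ k - 1) * t + 1" and s2: "2 * s2 = (2 ^ k + 1) * t + 1"
  defines "T \<equiv> \<lambda>p. T1 (2 * m) d1 d2 (fst p) (snd p :: 'a)"
  shows "\<exists>h N0 N1 N2 N3. int q + 1 = int h * int l
    \<and> range T \<subseteq> {int q ^ 2, (3 * int l - 1) * q, (2 * int l - 1) * q, (int l - 1) * q, - int q}
    \<and> card {p. T p = int q ^ 2} = 1
    \<and> card {p. T p = (3 * int l - 1) * q} = N3
    \<and> card {p. T p = (2 * int l - 1) * q} = N2
    \<and> card {p. T p = (int l - 1) * q} = N1
    \<and> card {p. T p = - int q} = N0
    \<and> N0 + N1 + N2 + N3 + 1 = q ^ 4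
    \<and> N1 + 2 * N2 + 3 * N3 + h = h * q ^ 3
    \<and> N2 + 3 * N3 + (h choose 2) = (h choose 2) * q ^ 2
    \<and> N3 + (h choose 3) = (h choose 3) * q"
proof -
  define H where "H = (\<lambda>z. z ^ t) ` U"
  define h where "h = card H"
  define M where "M p = card {w \<in> H. niho_form k p w = 0}" for p
  have HU: "H \<subseteq> U" using U_power by (auto simp: H_def)
  have hl: "q + 1 = l * h"
    using card_power_preimage[OF t, of "\<lambda>_. True"] card_U l by (simp add: H_def h_def)
  have l0: "l > 0" using t l by simp
  have TM: "T p = int q * (int l * int (M p) - 1)" for p
  proof -
    have "T p = int q * int (card {z \<in> U. niho_form k p (z ^ t) = 0}) - int q"
      using T1_eq_niho_form_count[OF d1 d2 s1 s2, of "fst p" "snd p"] by (simp add: T_def)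
    also have "card {z \<in> U. niho_form k p (z ^ t) = 0} = l * M p"
      using card_power_preimage[OF t, of "\<lambda>w. niho_form k p w = 0"] by (simp only: M_def H_def l)
    finally show ?thesis by (simp add: right_diff_distrib)
  qed
  \<comment> \<open>Since \<open>l\<close> divides \<open>t\<close>, \<open>q + 1\<close> divides
    \<open>h * t\<close>, so by the non-congruences \<open>h\<close> divides neither
    \<open>2 ^ k - 1\<close> nor \<open>2 ^ k + 1\<close>. This excludes 1 and 3, and
    \<open>h\<close> is odd as a divisor of \<open>q + 1\<close>.\<close>
  have h4: "h \<ge> 4"
  proof -
    have "l dvd t" unfolding l by (rule gcd_dvd1)
    then have dvd_ht: "q + 1 dvd h * t" unfolding hl mult.commute[of l] by (rule mult_dvd_mono[OF dvd_refl])
    have no: "\<not> h dvd 2 ^ k - 1" "\<not> h dvd 2 ^ k + 1"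
      using nz1 nz2 dvd_trans[OF dvd_ht mult_dvd_mono[OF _ dvd_refl]] by blast+
    then have "h \<noteq> 1" "h \<noteq> 3" using three_dvd_pow2[of k] by auto
    moreover have "odd (l * h)" unfolding hl[symmetric] using m_pos by simp
    then have "odd h" by simp
    ultimately show ?thesis by presburger
  qed
  have M0: "M 0 = h" by (simp add: M_def h_def niho_form_def power_0_left)
  have M3: "M p \<le> 3" if "p \<noteq> 0" for p
  proof (rule ccontr)
    assume "\<not> M p \<le> 3"
    then have "4 \<le> card {w \<in> H. niho_form k p w = 0}" by (simp add: M_def)
    then obtain S where S: "S \<subseteq> {w \<in> H. niho_form k p w = 0}" "card S = 4"
      by (rule obtain_subset_with_card_n)
    then have "annihilator k S = {(0, 0)}" using HU by (intro annihilator_four_points[OF cop]) auto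
    moreover have "p \<in> annihilator k S" using S by (auto simp: annihilator_def)
    ultimately show False using that by (simp add: zero_prod_def)
  qed
  define N where "N i = card {p. p \<noteq> 0 \<and> M p = i}" for i
  \<comment> \<open>A \<open>j\<close>-subset of \<open>H\<close> is annihilated by
    \<open>q ^ (4 - j)\<close> pairs. The sum over all pairs is then split into the zero pair and
    the classes with \<open>M p = i \<le> 3\<close>.\<close>
  have moment: "(\<Sum>i\<le>3. (i choose j) * N i) + (h choose j) = (h choose j) * q ^ (4 - j)" if "j \<le> 3" for j
  proof -
    have "(\<Sum>p\<in>UNIV. M p choose j) = (h choose j) * q ^ (4 - j)"
      unfolding M_def h_def
    proof (rule sum_card_choose)
      fix S assume "S \<subseteq> H" "card S = j"
      then show "card {p \<in> UNIV. \<forall>w\<in>S. niho_form k p w = 0} = q ^ (4 - j)"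
        using card_annihilator[OF cop m, of S] HU that by (simp add: annihilator_def)
    qed auto
    also have "(\<Sum>p\<in>UNIV. M p choose j) = (\<Sum>p\<in>- {0}. M p choose j) + (h choose j)"
      using sum.remove[of UNIV 0 "\<lambda>p. M p choose j"] M0 by (simp add: Compl_eq_Diff_UNIV)
    also have "(\<Sum>p\<in>- {0}. M p choose j) = (\<Sum>i\<le>3. \<Sum>p\<in>{p \<in> - {0}. M p = i}. M p choose j)"
      using M3 by (intro sum.group[symmetric]) auto
    also have "\<dots> = (\<Sum>i\<le>3. (i choose j) * N i)"
      by (simp add: N_def mult.commute)
    finally show ?thesis .
  qed
  have q0: "q > 0" by simp
  have T_iff: "T p = (int i * int l - 1) * q \<longleftrightarrow> M p = i" for p i
    using q0 l0 unfolding TM by (auto simp: mult.commute)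
  have T_val: "card {p. T p = (int i * int l - 1) * q} = N i" if "i \<le> 3" for i
  proof -
    have "{p. T p = (int i * int l - 1) * q} = {p. p \<noteq> 0 \<and> M p = i}"
      unfolding T_iff using M0 h4 that by auto
    then show ?thesis by (simp add: N_def)
  qed
  have hl': "int q + 1 = int h * int l" using arg_cong[OF hl, of int] by (simp add: mult.commute)
  \<comment> \<open>The value \<open>q ^ 2\<close> corresponds to \<open>M p = h\<close>, which only
    the zero pair attains because \<open>h > 3\<close>.\<close>
  have q2: "int q ^ 2 = (int h * int l - 1) * q"
    using hl'[symmetric] by (simp add: power2_eq_square)
  have T_zero: "T p = int q ^ 2 \<longleftrightarrow> p = 0" for p
    unfolding q2 T_iff using M0 M3[of p] h4 by force
  then have "card {p. T p = int q ^ 2} = 1" by simp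
  moreover have "range T \<subseteq> {int q ^ 2, (3 * int l - 1) * q, (2 * int l - 1) * q, (int l - 1) * q, - int q}"
  proof
    fix x assume "x \<in> range T"
    then obtain p where x: "x = T p" by blast
    have "p = 0 \<or> M p = 0 \<or> M p = 1 \<or> M p = 2 \<or> M p = 3"
      using M3[of p] by (cases "p = 0") (auto simp: numeral_eq_Suc le_Suc_eq)
    then show "x \<in> {int q ^ 2, (3 * int l - 1) * q, (2 * int l - 1) * q, (int l - 1) * q, - int q}"
      unfolding x using T_iff[of p 0] T_iff[of p 1] T_iff[of p 2] T_iff[of p 3] T_zero[of p] by auto
  qed
  moreover have "N 0 + N 1 + N 2 + N 3 + 1 = q ^ 4"
    "N 1 + 2 * N 2 + 3 * N 3 + h = h * q ^ 3"
    "N 2 + 3 * N 3 + (h choose 2) = (h choose 2) * q ^ 2"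
    "N 3 + (h choose 3) = (h choose 3) * q"
  proof -
    have four: "(\<Sum>i\<le>3. f i) = f 0 + f 1 + f 2 + f 3" for f :: "nat \<Rightarrow> nat"
      by (simp add: numeral_2_eq_2 numeral_3_eq_3)
    have choose: "(3 choose 2) = (3::nat)"
      by (simp add: numeral_2_eq_2 numeral_3_eq_3)
    show "N 0 + N 1 + N 2 + N 3 + 1 = q ^ 4" "N 1 + 2 * N 2 + 3 * N 3 + h = h * q ^ 3"
      "N 2 + 3 * N 3 + (h choose 2) = (h choose 2) * q ^ 2"
      "N 3 + (h choose 3) = (h choose 3) * q"
      using moment[of 0] moment[of 1] moment[of 2] moment[of 3] choose unfolding four
      by (simp_all add: binomial_eq_0)
  qed
  moreover have "card {p. T p = - int q} = N 0" "card {p. T p = (int l - 1) * q} = N 1"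
    "card {p. T p = (2 * int l - 1) * q} = N 2" "card {p. T p = (3 * int l - 1) * q} = N 3"
    using T_val[of 0] T_val[of 1] T_val[of 2] T_val[of 3] by simp_all
  ultimately show ?thesis using hl' by blast
qed

end

section \<open>The distribution in closed form\<close>

theorem theorem11:
  fixes m n k t s1 s2 d1 d2 l :: nat
  assumes card: "CARD('a::finite_field) = 2 ^ n"
    and m: "m \<ge> 2"
    and n: "n = 2 * m"
    and k: "1 \<le> k" "k \<le> m"
    and t: "odd t" "1 \<le> t" "t \<le> 2 ^ m + 1"
    and s1: "s1 = 2 ^ (k - 1) * t - (t - 1) div 2"
    and s2: "s2 = 2 ^ (k - 1) * t + (t + 1) div 2"
    and d1: "d1 = s1 * (2 ^ m - 1) + 1"
    and d2: "d2 = s2 * (2 ^ m - 1) + 1"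
    and nz1: "\<not> [(2 ^ k - 1) * int t = 0] (mod (2 ^ m + 1))"
    and nz2: "\<not> [(2 ^ k + 1) * int t = 0] (mod (2 ^ m + 1))"
    and l: "l = gcd t (2 ^ m + 1)"
    and cond: "[int m = - 1] (mod int k) \<or> gcd k (2 * m) = 1"
  shows
    "(\<forall>a b :: 'a. T1 n d1 d2 a b \<in>
        {2 ^ (2 * m), (3 * int l - 1) * 2 ^ m, (2 * int l - 1) * 2 ^ m,
         (int l - 1) * 2 ^ m, - (2 ^ m)})
     \<and> card {(a :: 'a, b :: 'a). T1 n d1 d2 a b = 2 ^ (2 * m)} = 1
     \<and> real (card {(a :: 'a, b :: 'a). T1 n d1 d2 a b = (3 * int l - 1) * 2 ^ m}) =
          (2 ^ (2 * m) - 1) * (2 ^ m + 1 - 2 * real l) * (2 ^ m + 1 - real l) / (6 * real l ^ 3)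
     \<and> real (card {(a :: 'a, b :: 'a). T1 n d1 d2 a b = (2 * int l - 1) * 2 ^ m}) =
          (2 ^ (2 * m) - 1) * ((2 ^ m + 3) * real l - 2 ^ m - 1) * (2 ^ m + 1 - real l)
          / (2 * real l ^ 3)
     \<and> real (card {(a :: 'a, b :: 'a). T1 n d1 d2 a b = (int l - 1) * 2 ^ m}) =
          (2 ^ (2 * m) - 1) *
          ((2 ^ (2 * m + 1) + 2 ^ (m + 2) + 6) * real l ^ 2
           - (2 ^ (2 * m + 1) + 7 * 2 ^ m + 5) * real l + (2 ^ m + 1) ^ 2)
          / (2 * real l ^ 3)
     \<and> real (card {(a :: 'a, b :: 'a). T1 n d1 d2 a b = - (2 ^ m)}) =
          (2 ^ (2 * m) - 1) *
          (6 * (2 ^ (2 * m) + 1) * real l ^ 3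
           - (6 * 2 ^ (2 * m) + 9 * 2 ^ m + 11) * real l ^ 2
           + (3 * 2 ^ (2 * m) + 9 * 2 ^ m + 6) * real l - (2 ^ m + 1) ^ 2)
          / (6 * real l ^ 3)"
proof -
  interpret even_degree_field m "TYPE('a)"
    using card m n by unfold_locales auto
  have "coprime k m"
    using cond
  proof
    assume "gcd k (2 * m) = 1"
    then have "coprime k (2 * m)" by (simp only: coprime_iff_gcd_eq_1)
    then show ?thesis by simp
  qed (rule coprime_of_cong_minus_1)
  obtain r where r: "t = 2 * r + 1" using t(1) by (rule oddE)
  have pow_k: "(2::nat) ^ k = 2 * 2 ^ (k - 1)" using k(1) by (cases k) auto
  \<comment> \<open>This bound makes the natural subtractions in \<open>s1\<close> and
    \<open>(2 ^ k - 1) * t\<close> exact.\<close>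
  have "t \<le> 2 ^ (k - 1) * t" using mult_le_mono1[of 1 "2 ^ (k - 1)" t] by simp
  moreover have "(2 ^ k - 1) * t = 2 * (2 ^ (k - 1) * t) - t"
    unfolding pow_k diff_mult_distrib by simp
  moreover have "(t - 1) div 2 = r" by (simp add: r)
  ultimately have s1': "2 * s1 = (2 ^ k - 1) * t + 1"
    unfolding s1 using r by linarith
  have s2': "2 * s2 = (2 ^ k + 1) * t + 1"
    unfolding s2 pow_k by (simp add: r algebra_simps)
  have one: "int (2 ^ k - 1) = 2 ^ k - 1" by (simp add: of_nat_diff)
  have nz1': "\<not> q + 1 dvd (2 ^ k - 1) * t"
  proof
    assume "q + 1 dvd (2 ^ k - 1) * t"
    then have "int (q + 1) dvd int ((2 ^ k - 1) * t)" by (simp only: int_dvd_int_iff)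
    then show False using nz1 by (simp add: cong_0_iff one add.commute)
  qed
  have nz2': "\<not> q + 1 dvd (2 ^ k + 1) * t"
  proof
    assume "q + 1 dvd (2 ^ k + 1) * t"
    then have "int (q + 1) dvd int ((2 ^ k + 1) * t)" by (simp only: int_dvd_int_iff)
    then show False using nz2 by (simp add: cong_0_iff algebra_simps)
  qed
  have "t > 0" using t(2) by simp
  define T where "T p = T1 n d1 d2 (fst p) (snd p :: 'a)" for p
  obtain h N0 N1 N2 N3 where hl: "int q + 1 = int h * int l"
    and range: "range T \<subseteq> {int q ^ 2, (3 * int l - 1) * q, (2 * int l - 1) * q, (int l - 1) * q, - int q}"
    and cards: "card {p. T p = int q ^ 2} = 1" "card {p. T p = (3 * int l - 1) * q} = N3"
      "card {p. T p = (2 * int l - 1) * q} = N2" "card {p. T p = (int l - 1) * q} = N1"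
      "card {p. T p = - int q} = N0"
    and moments: "N0 + N1 + N2 + N3 + 1 = q ^ 4" "N1 + 2 * N2 + 3 * N3 + h = h * q ^ 3"
      "N2 + 3 * N3 + (h choose 2) = (h choose 2) * q ^ 2" "N3 + (h choose 3) = (h choose 3) * q"
    using T1_value_distribution[OF \<open>coprime k m\<close> m \<open>t > 0\<close> l nz1' nz2' d1 d2 s1' s2',
        folded n, folded T_def] by (elim exE conjE) (rule that)
  have pairs: "{(a, b). T1 n d1 d2 a b = c} = {p. T p = c}" for c
    by (auto simp: T_def)
  have sq: "(2::int) ^ (2 * m) = int q ^ 2" "(2::real) ^ (2 * m) = real q ^ 2"
    by (simp_all add: power_mult mult.commute[of 2])
  have pow: "(2::real) ^ (2 * m + 1) = 2 * real q ^ 2" "(2::real) ^ (m + 2) = 4 * real q"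
    by (simp_all add: power_add sq)
  have choose2: "real (h choose 2) = real h * (real h - 1) / 2"
    by (cases h) (simp_all add: choose_two real_of_nat_div algebra_simps)
  have choose3: "real (h choose 3) = real h * (real h - 1) * (real h - 2) / 6"
    by (simp add: binomial_gbinomial gbinomial_prod_rev numeral_3_eq_3 fact_numeral algebra_simps)
  have "real l > 0" using l by simp
  have hl_real: "real q + 1 = real h * real l"
    using arg_cong[OF hl, of real_of_int] by simp
  \<comment> \<open>Moving each \<open>h choose j\<close> to the right gives the factors
    \<open>q ^ (4 - j) - 1\<close> expected by \<open>solve_moments\<close>.\<close>
  have moments_real:
    "real N0 + real N1 + real N2 + real N3 = real q ^ 4 - 1"
    "real N1 + 2 * real N2 + 3 * real N3 = real h * (real q ^ 3 - 1)"
    "real N2 + 3 * real N3 = real h * (real h - 1) / 2 * (real q ^ 2 - 1)"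
    "real N3 = real h * (real h - 1) * (real h - 2) / 6 * (real q - 1)"
    using arg_cong[OF moments(1), of real] arg_cong[OF moments(2), of real]
      arg_cong[OF moments(3), of real] arg_cong[OF moments(4), of real]
    unfolding choose2[symmetric] choose3[symmetric] by (simp_all add: algebra_simps)
  note solution = solve_moments[OF \<open>real l > 0\<close> hl_real moments_real]
  have "T1 n d1 d2 a b \<in> {2 ^ (2 * m), (3 * int l - 1) * 2 ^ m, (2 * int l - 1) * 2 ^ m,
      (int l - 1) * 2 ^ m, - (2 ^ m)}" for a b :: 'a
    using range rangeI[of T "(a, b)"] unfolding sq by (auto simp: T_def)
  then show ?thesis
    unfolding pairs using cards solution unfolding sq pow by simp
qed

end
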